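(* Let $V:\mathrm{Lip}(S^{n-1})\longrightarrow\mathbb{R}$ be a $\tau$-continuous valuation. Then $V$ is bounded on $\|\cdot\|_{\mathrm{Lip}}$-bounded sets, i.e. for every $M>0$ we have $\sup\{|V(f)|: f\in\mathrm{Lip}(S^{n-1}),\ \|f\|_{\mathrm{Lip}}\le M\}<\infty$.
   Context: $n\in\mathbb{N}$, $S^{n-1}$ is the Euclidean unit sphere of $\mathbb{R}^n$, and $\mathrm{Lip}(S^{n-1})$ is the space of functions $f:S^{n-1}\to\mathbb{R}$ with finite Lipschitz constant $L(f)=\sup_{x\ne y}|f(x)-f(y)|/\|x-y\|$ ($\|\cdot\|$ the Euclidean norm of $\mathbb{R}^n$), with norm $\|f\|_{\mathrm{Lip}}=\max\{\|f\|_\infty,L(f)\}$. A valuation is a map $V:\mathrm{Lip}(S^{n-1})\to\mathbb{R}$ with $V(f\vee g)+V(f\wedge g)=V(f)+V(g)$ for all $f,g$, where $\vee,\wedge$ are pointwise maximum and minimum. $H^{n-1}$ is the Hausdorff measure on $S^{n-1}$ normalized so that $H^{n-1}(S^{n-1})=1$; "a.e." refers to it. $\nabla f(x)$ is the spherical (tangential) gradient of $f$ at $x$, which exists for a.e. $x$ by Rademacher's theorem. For $f,f_k\in\mathrm{Lip}(S^{n-1})$, $f_k\overset{\tau}{\rightarrow}f$ means: (1) $\|f_k-f\|_\infty\to0$; (2) there is $C>0$ with $\sup_k\|\nabla f_k(x)\|\le C$ for a.e. $x$; (3) $\nabla f_k(x)\to\nabla f(x)$ for a.e. $x$. $V$ is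 $\tau$-continuous if $V(f_k)\to V(f)$ whenever $f_k\overset{\tau}{\rightarrow}f$. *)

theory Defs
  imports "HOL-Analysis.Analysis"
begin

section \<open>The normalized Hausdorff measure of the sphere\<close>

text \<open>
  The usual dimensional factor in front of \<open>diameter (U i) ^ d\<close> is omitted: it
  cancels in the normalization below. The case distinction gives the empty set weight 0 also for
  \<open>d = 0\<close>, whereas points then have weight \<open>0 ^ 0 = 1\<close> (counting measure).
  Boundedness is required because \<^const>\<open>diameter\<close> is unspecified on unbounded sets.
\<close>

definition hausdorff_pre :: "nat \<Rightarrow> real \<Rightarrow> 'a::metric_space set \<Rightarrow> ennreal" where
  "hausdorff_pre d \<delta> A =
     (INF U \<in> {U :: nat \<Rightarrow> 'a set. A \<subseteq> (\<Union>i. U i) \<and> (\<forall>i. bounded (U i) \<and> diameter (U i) \<le> \<delta>)}.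
        \<Sum>i. if U i = {} then 0 else ennreal (diameter (U i) ^ d))"

definition hausdorff_outer :: "nat \<Rightarrow> 'a::metric_space set \<Rightarrow> ennreal" where
  "hausdorff_outer d A = (SUP \<delta> \<in> {0<..}. hausdorff_pre d \<delta> A)"

definition hausdorff_measure :: "nat \<Rightarrow> 'a::metric_space set \<Rightarrow> 'a measure" where
  "hausdorff_measure d X =
     measure_of X (lambda_system X (Pow X) (hausdorff_outer d)) (hausdorff_outer d)"

definition sphere_measure :: "(real ^ 'n) measure" where
  "sphere_measure =
     (let H = hausdorff_measure (CARD('n) - 1) (sphere (0 :: real ^ 'n) 1)
      in scale_measure (1 / emeasure H (space H)) H)"

text \<open>The Caratheodory construction does yield a measure with the intended values.\<close>

lemma hausdorff_pre_empty: "0 \<le> \<delta> \<Longrightarrow> hausdorff_pre d \<delta> ({} :: 'a::metric_space set) = 0"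
  unfolding hausdorff_pre_def
  by (intro antisym INF_lower2[of "\<lambda>_. {}"]) auto

lemma hausdorff_pre_mono: "A \<subseteq> B \<Longrightarrow> hausdorff_pre d \<delta> A \<le> hausdorff_pre d \<delta> B"
  unfolding hausdorff_pre_def by (intro INF_superset_mono) auto

lemma hausdorff_pre_countably_subadditive:
  fixes A :: "nat \<Rightarrow> 'a::metric_space set"
  shows "hausdorff_pre d \<delta> (\<Union>i. A i) \<le> (\<Sum>n. hausdorff_pre d \<delta> (A n))"
proof (rule ennreal_le_epsilon)
  let ?O = "hausdorff_pre d \<delta> :: 'a set \<Rightarrow> ennreal"
  define f where "f U = (if U = {} then 0 else ennreal (diameter U ^ d))" for U :: "'a set"
  define M where "M = {U :: 'a set. bounded U \<and> diameter U \<le> \<delta>}"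
  have O: "?O X = (INF U \<in> {U. X \<subseteq> (\<Union>i. U i) \<and> range U \<subseteq> M}. \<Sum>i. f (U i))" for X
    unfolding hausdorff_pre_def f_def M_def by (rule INF_cong) auto
  fix e :: real assume e: "0 < e" and "(\<Sum>n. ?O (A n)) < top"
  then have *: "\<And>n. ?O (A n) < ?O (A n) + e * (1/2)^Suc n"
    by (auto simp add: less_top dest!: ennreal_suminf_lessD)
  have "\<exists>B. range B \<subseteq> M \<and> A n \<subseteq> (\<Union>i. B i) \<and> (\<Sum>i. f (B i)) \<le> ?O (A n) + e * (1/2)^(Suc n)" for n
    using *[of n] unfolding O[of "A n"] INF_less_iff by (auto intro: less_imp_le)
  then obtain B where B: "\<And>n. range (B n) \<subseteq> M"
    and sbB: "\<And>n. A n \<subseteq> (\<Union>i. B n i)"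
    and Ble: "\<And>n. (\<Sum>i. f (B n i)) \<le> ?O (A n) + e * (1/2)^(Suc n)"
    by metis
  define C where "C = case_prod B o prod_decode"
  have C: "range C \<subseteq> M"
    using B by (auto simp add: C_def split_def)
  have A_C: "(\<Union>i. A i) \<subseteq> (\<Union>i. C i)"
    using sbB by (auto simp add: C_def subset_eq) (metis prod.case prod_encode_inverse)
  have "?O (\<Union>i. A i) \<le> (\<Sum>i. f (C i))"
    unfolding O by (rule INF_lower) (use C A_C in auto)
  also have "\<dots> = (\<Sum>n. \<Sum>i. f (B n i))"
    unfolding C_def comp_def by (intro suminf_ennreal_2dimen) auto
  also have "\<dots> \<le> (\<Sum>n. ?O (A n) + e * (1/2) ^ Suc n)"
    by (intro suminf_le allI Ble) auto
  also have "\<dots> = (\<Sum>n. ?O (A n)) + (\<Sum>n. ennreal e * ennreal ((1/2) ^ Suc n))"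
    using e by (subst suminf_add[symmetric])
      (auto simp del: ennreal_suminf_cmult simp add: ennreal_mult[symmetric])
  also have "\<dots> = (\<Sum>n. ?O (A n)) + e"
    unfolding ennreal_suminf_cmult
    by (subst suminf_ennreal_eq[OF zero_le_power power_half_series]) auto
  finally show "?O (\<Union>i. A i) \<le> (\<Sum>n. ?O (A n)) + e" .
qed

lemma outer_measure_space_hausdorff_outer:
  "outer_measure_space (Pow X) (hausdorff_outer d)"
  unfolding outer_measure_space_def
proof (intro conjI)
  have "hausdorff_outer d ({} :: 'a set) \<le> 0"
    unfolding hausdorff_outer_def by (rule SUP_least) (simp add: hausdorff_pre_empty)
  then show "positive (Pow X) (hausdorff_outer d)"
    by (simp add: positive_def)
  show "increasing (Pow X) (hausdorff_outer d)"
    unfolding increasing_def hausdorff_outer_def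
    by (auto intro!: SUP_mono' hausdorff_pre_mono)
  show "countably_subadditive (Pow X) (hausdorff_outer d)"
    unfolding countably_subadditive_def
  proof (intro allI impI)
    fix A :: "nat \<Rightarrow> 'a set"
    show "hausdorff_outer d (\<Union>i. A i) \<le> (\<Sum>i. hausdorff_outer d (A i))"
      unfolding hausdorff_outer_def[of d "\<Union>i. A i"]
    proof (rule SUP_least)
      fix \<delta> :: real assume "\<delta> \<in> {0<..}"
      then have "hausdorff_pre d \<delta> (A i) \<le> hausdorff_outer d (A i)" for i
        unfolding hausdorff_outer_def by (rule SUP_upper)
      then show "hausdorff_pre d \<delta> (\<Union>i. A i) \<le> (\<Sum>i. hausdorff_outer d (A i))"
        by (intro order_trans[OF hausdorff_pre_countably_subadditive] suminf_le) auto
    qed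
  qed
qed

lemma measure_space_hausdorff:
  "measure_space X (lambda_system X (Pow X) (hausdorff_outer d)) (hausdorff_outer d)"
  by (rule sigma_algebra.caratheodory_lemma[OF sigma_algebra_Pow outer_measure_space_hausdorff_outer])

lemma space_hausdorff_measure [simp]: "space (hausdorff_measure d X) = X"
  unfolding hausdorff_measure_def
  by (rule space_measure_of) (auto simp: lambda_system_def)

lemma sets_hausdorff_measure:
  "sets (hausdorff_measure d X) = lambda_system X (Pow X) (hausdorff_outer d)"
  unfolding hausdorff_measure_def using measure_space_hausdorff[of X d]
  by (simp add: measure_space_def sigma_algebra.sets_measure_of_eq)

lemma emeasure_hausdorff_measure:
  assumes "A \<in> sets (hausdorff_measure d X)"
  shows "emeasure (hausdorff_measure d X) A = hausdorff_outer d A"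
  using measure_space_hausdorff[of X d] assms unfolding sets_hausdorff_measure
  unfolding hausdorff_measure_def measure_space_def
  by (intro emeasure_measure_of_sigma) auto


section \<open>Lipschitz functions on the sphere\<close>

text \<open>
  A function on the sphere is represented by its extension with value \<^const>\<open>undefined\<close> off the
  sphere, so that two elements of \<open>Lip_sphere\<close> are equal iff they agree on the sphere. Pointwise
  maxima and minima of such functions are again of this form.
\<close>

definition lip_quotients :: "(real ^ 'n \<Rightarrow> real) \<Rightarrow> real set" where
  "lip_quotients f = {\<bar>f x - f y\<bar> / norm (x - y) | x y. x \<in> sphere 0 1 \<and> y \<in> sphere 0 1 \<and> x \<noteq> y}"

definition Lip_sphere :: "(real ^ 'n \<Rightarrow> real) set" where
  "Lip_sphere = {f \<in> extensional (sphere 0 1). bdd_above (lip_quotients f)}"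

definition lip_const :: "(real ^ 'n \<Rightarrow> real) \<Rightarrow> real" where
  "lip_const f = Sup (lip_quotients f)"

definition sup_norm :: "(real ^ 'n \<Rightarrow> real) \<Rightarrow> real" where
  "sup_norm f = (SUP x \<in> sphere 0 1. \<bar>f x\<bar>)"

definition lip_norm :: "(real ^ 'n \<Rightarrow> real) \<Rightarrow> real" where
  "lip_norm f = max (sup_norm f) (lip_const f)"

lemma bdd_above_lip_quotients_iff:
  fixes f :: "real ^ 'n \<Rightarrow> real"
  shows "bdd_above (lip_quotients f) \<longleftrightarrow> (\<exists>C. C-lipschitz_on (sphere 0 1) f)"
proof
  assume "bdd_above (lip_quotients f)"
  then obtain C where C: "\<And>q. q \<in> lip_quotients f \<Longrightarrow> q \<le> C"
    by (auto simp: bdd_above_def)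
  have "dist (f x) (f y) \<le> max 0 C * dist x y" if "x \<in> sphere 0 1" "y \<in> sphere 0 1" for x y
  proof (cases "x = y")
    case False
    then have "\<bar>f x - f y\<bar> / norm (x - y) \<le> C"
      using that by (intro C) (auto simp: lip_quotients_def)
    then have "\<bar>f x - f y\<bar> / norm (x - y) \<le> max 0 C" by simp
    then show ?thesis
      using False by (simp add: dist_norm divide_le_eq)
  qed auto
  then have "(max 0 C)-lipschitz_on (sphere 0 1) f"
    by (intro lipschitz_onI) auto
  then show "\<exists>C. C-lipschitz_on (sphere 0 1) f" ..
next
  assume "\<exists>C. C-lipschitz_on (sphere 0 1) f"
  then obtain C where "C-lipschitz_on (sphere 0 1) f" ..
  then have "q \<le> C" if "q \<in> lip_quotients f" for q
    using that by (force simp: lip_quotients_def divide_le_eq dist_norm dest: lipschitz_onD)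
  then show "bdd_above (lip_quotients f)"
    by (auto simp: bdd_above_def)
qed


section \<open>Spherical gradient, \<open>\<tau>\<close>-convergence and valuations\<close>

definition has_spherical_gradient :: "(real ^ 'n \<Rightarrow> real) \<Rightarrow> real ^ 'n \<Rightarrow> real ^ 'n \<Rightarrow> bool" where
  "has_spherical_gradient f v x \<longleftrightarrow>
     v \<bullet> x = 0 \<and> (f has_derivative (\<lambda>h. v \<bullet> h)) (at x within sphere 0 1)"

text \<open>
  The derivative within the sphere determines its values on the tangent space only; the condition
  \<open>v \<bullet> x = 0\<close> selects the tangential representative, which is unique.
\<close>

lemma has_spherical_gradient_unique:
  fixes f :: "real ^ 'n \<Rightarrow> real"
  assumes x: "x \<in> sphere 0 1"
    and v: "has_spherical_gradient f v x" and w: "has_spherical_gradient f w x"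
  shows "v = w"
proof (rule ccontr)
  assume "v \<noteq> w"
  define u where "u = v - w"
  define e where "e = u /\<^sub>R norm u"
  define c where "c t = cos t *\<^sub>R x + sin t *\<^sub>R e" for t :: real
  have u: "u \<noteq> 0" "u \<bullet> x = 0"
    using \<open>v \<noteq> w\<close> v w by (auto simp: u_def has_spherical_gradient_def inner_diff_left)
  have e: "e \<bullet> e = 1" "x \<bullet> e = 0" "x \<bullet> x = 1"
    using u x by (auto simp: e_def dot_square_norm inner_commute power2_eq_square)
  have "c t \<bullet> c t = 1" for t
    using sin_cos_squared_add2[of t] e
    by (simp add: c_def inner_add_left inner_add_right inner_commute[of e x] power2_eq_square)
  then have c: "range c \<subseteq> sphere 0 1"
    by (auto simp: norm_eq_sqrt_inner)
  have c': "(c has_derivative (\<lambda>t. t *\<^sub>R e)) (at 0)"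
    unfolding c_def by (auto intro!: derivative_eq_intros)
  have "((\<lambda>y. f y - f y) has_derivative (\<lambda>h. v \<bullet> h - w \<bullet> h)) (at x within sphere 0 1)"
    using v w unfolding has_spherical_gradient_def by (intro has_derivative_diff) auto
  then have "((\<lambda>y. 0 :: real) has_derivative (\<lambda>h. u \<bullet> h)) (at (c 0) within sphere 0 1)"
    by (simp add: u_def inner_diff_left c_def)
  then have "((\<lambda>y. 0 :: real) has_derivative (\<lambda>h. u \<bullet> h)) (at (c 0) within range c)"
    by (rule has_derivative_subset[OF _ c])
  from has_derivative_in_compose[OF c' this]
  have "((\<lambda>t. 0 :: real) has_derivative (\<lambda>t. u \<bullet> (t *\<^sub>R e))) (at 0)" .
  then have "(\<lambda>t :: real. u \<bullet> (t *\<^sub>R e)) = (\<lambda>t. 0)"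
    by (rule has_derivative_unique) simp
  from fun_cong[OF this, of 1] have "u \<bullet> e = 0" by simp
  with u show False
    by (simp add: e_def)
qed

definition spherical_gradient :: "(real ^ 'n \<Rightarrow> real) \<Rightarrow> real ^ 'n \<Rightarrow> real ^ 'n" where
  "spherical_gradient f x = (THE v. has_spherical_gradient f v x)"

definition tau_converges :: "(nat \<Rightarrow> real ^ 'n \<Rightarrow> real) \<Rightarrow> (real ^ 'n \<Rightarrow> real) \<Rightarrow> bool" where
  "tau_converges F f \<longleftrightarrow>
     (\<lambda>k. sup_norm (\<lambda>x. F k x - f x)) \<longlonglongrightarrow> 0 \<and>
     (\<exists>C>0. AE x in sphere_measure. \<forall>k. norm (spherical_gradient (F k) x) \<le> C) \<and>
     (AE x in sphere_measure. (\<lambda>k. spherical_gradient (F k) x) \<longlonglongrightarrow> spherical_gradient f x)"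

definition tau_continuous :: "((real ^ 'n \<Rightarrow> real) \<Rightarrow> real) \<Rightarrow> bool" where
  "tau_continuous V \<longleftrightarrow>
     (\<forall>F f. (\<forall>k. F k \<in> Lip_sphere) \<and> f \<in> Lip_sphere \<and> tau_converges F f \<longrightarrow>
        (\<lambda>k. V (F k)) \<longlonglongrightarrow> V f)"

definition valuation :: "((real ^ 'n \<Rightarrow> real) \<Rightarrow> real) \<Rightarrow> bool" where
  "valuation V \<longleftrightarrow>
     (\<forall>f \<in> Lip_sphere. \<forall>g \<in> Lip_sphere.
        V (\<lambda>x. max (f x) (g x)) + V (\<lambda>x. min (f x) (g x)) = V f + V g)"

end

theory Submission
  imports Defs
begin

text \<open>
  The two hypotheses on \<open>V\<close> play different parts. Continuity gives boundedness on a small class of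
  functions, by compactness; the valuation identity reduces all functions to that class by cutting.

  The small class consists of the \<open>M\<close>-Lipschitz functions within \<open>r\<close> of a constant \<open>c \<in> [-M, M]\<close> and
  equal to \<open>c\<close> outside the ball of radius \<open>r\<close> about some point \<open>p\<close> of the sphere. If \<open>V\<close> were
  unbounded on this class for every \<open>r > 0\<close>, there would be functions \<open>g\<^sub>k\<close> with radii tending to 0
  and \<open>\<bar>V g\<^sub>k\<bar>\<close> tending to infinity. Along a subsequence, \<open>p\<^sub>k\<close> converges to some \<open>q\<close> and \<open>c\<^sub>k\<close> to some \<open>d\<close>.
  Then \<open>g\<^sub>k\<close> converges uniformly to the constant \<open>d\<close>, the gradients are uniformly bounded, and at
  every \<open>x \<noteq> q\<close> the function \<open>g\<^sub>k\<close> is eventually constant near \<open>x\<close>, so that its gradient is 0. The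
  single point \<open>q\<close> is a null set or, on the two-point sphere of dimension 0, isolated. Hence
  \<open>g\<^sub>k\<close> is \<open>\<tau>\<close>-convergent to a constant, and \<open>V g\<^sub>k\<close> converges, a contradiction
  (lemmas \<open>tau_converges_concentrating\<close> and \<open>bounded_on_concentrated\<close>).

  Now fix such an \<open>r\<close>. For a fixed Lipschitz function \<open>\<phi>\<close>, the identity
  \<open>V f = V (max f \<phi>) + V (min f \<phi>) - V \<phi>\<close> bounds \<open>V f\<close> once the two truncations of \<open>f\<close> are under
  control. Cutting with finitely many constants reduces the problem to functions with values in an
  interval \<open>[a, a + s]\<close>, where \<open>s\<close> may be as small as desired. Such functions are cut with truncated
  cones \<open>\<phi>\<close> of slope \<open>M\<close> and height \<open>s\<close>: the upper part \<open>max f \<phi>\<close> is constant outside a ball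
  of radius \<open>2 s / M\<close> and so, for small \<open>s\<close>, in the small class; the lower part \<open>min f \<phi>\<close> is constant
  on the concentric ball of radius \<open>s / M\<close>. After cutting with the cones over a finite
  cover of the sphere by balls of radius \<open>s / M\<close>, what remains below is the constant \<open>a\<close>
  (lemma \<open>bounded_on_thin\<close>). Small \<open>s\<close> makes it possible to localize without exceeding the
  Lipschitz constant \<open>M\<close>.
\<close>

section \<open>Lipschitz functions with bounded range\<close>

definition const_sphere :: "real \<Rightarrow> real ^ 'n \<Rightarrow> real" where
  "const_sphere c = restrict (\<lambda>_. c) (sphere 0 1)"

definition lip_between :: "real \<Rightarrow> real \<Rightarrow> real \<Rightarrow> (real ^ 'n \<Rightarrow> real) set" where
  "lip_between M a b =
     {f \<in> extensional (sphere 0 1). M-lipschitz_on (sphere 0 1) f \<and>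
        (\<forall>x \<in> sphere 0 1. a \<le> f x \<and> f x \<le> b)}"

lemma lip_between_Lip_sphere: "f \<in> lip_between M a b \<Longrightarrow> f \<in> Lip_sphere"
  by (auto simp: lip_between_def Lip_sphere_def bdd_above_lip_quotients_iff)

lemma const_sphere_lip_between:
  "0 \<le> M \<Longrightarrow> a \<le> c \<Longrightarrow> c \<le> b \<Longrightarrow> const_sphere c \<in> lip_between M a b"
  by (auto simp: lip_between_def const_sphere_def lipschitz_on_def)

lemma lipschitz_on_max_min:
  fixes f g :: "'a::metric_space \<Rightarrow> real"
  assumes "M-lipschitz_on S f" "M-lipschitz_on S g"
  shows "M-lipschitz_on S (\<lambda>x. max (f x) (g x))" "M-lipschitz_on S (\<lambda>x. min (f x) (g x))"
proof -
  have *: "\<bar>f x - f y\<bar> \<le> M * dist x y" "\<bar>g x - g y\<bar> \<le> M * dist x y" if "x \<in> S" "y \<in> S" for x y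
    using assms that by (auto simp: lipschitz_on_def dist_real_def)
  show "M-lipschitz_on S (\<lambda>x. max (f x) (g x))"
    using assms(1) * by (fastforce simp: lipschitz_on_def dist_real_def max_def)
  show "M-lipschitz_on S (\<lambda>x. min (f x) (g x))"
    using assms(1) * by (fastforce simp: lipschitz_on_def dist_real_def min_def)
qed

lemma lip_between_max:
  assumes "f \<in> lip_between M a b" "g \<in> lip_between M a' b'"
  shows "(\<lambda>x. max (f x) (g x)) \<in> lip_between M (max a a') (max b b')"
  using assms unfolding lip_between_def
  by (force simp: extensional_def intro!: lipschitz_on_max_min)

lemma lip_between_min:
  assumes "f \<in> lip_between M a b" "g \<in> lip_between M a' b'"
  shows "(\<lambda>x. min (f x) (g x)) \<in> lip_between M (min a a') (min b b')"
  using assms unfolding lip_between_def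
  by (force simp: extensional_def intro!: lipschitz_on_max_min)

lemma sphere_vec_nonempty: "sphere (0 :: real ^ 'n) 1 \<noteq> {}"
  by simp

lemma lip_norm_le_lip_between:
  fixes f :: "real ^ 'n \<Rightarrow> real"
  assumes f: "f \<in> Lip_sphere" and M: "lip_norm f \<le> M" "0 \<le> M"
  shows "f \<in> lip_between M (- M) M"
proof -
  have bdd: "bdd_above (lip_quotients f)" and ext: "f \<in> extensional (sphere 0 1)"
    using f by (auto simp: Lip_sphere_def)
  have "dist (f x) (f y) \<le> M * dist x y" if "x \<in> sphere 0 1" "y \<in> sphere 0 1" for x y
  proof (cases "x = y")
    case False
    then have "\<bar>f x - f y\<bar> / norm (x - y) \<le> lip_const f"
      unfolding lip_const_def using that by (intro cSup_upper bdd) (auto simp: lip_quotients_def)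
    then have "\<bar>f x - f y\<bar> / norm (x - y) \<le> M"
      using M by (simp add: lip_norm_def)
    then show ?thesis
      using False by (simp add: dist_norm divide_le_eq)
  qed auto
  then have lip: "M-lipschitz_on (sphere 0 1) f"
    using M by (intro lipschitz_onI) auto
  have "compact ((\<lambda>x. \<bar>f x\<bar>) ` sphere 0 1)"
    by (intro compact_continuous_image continuous_intros lipschitz_on_continuous_on[OF lip]) auto
  then have "bdd_above ((\<lambda>x. \<bar>f x\<bar>) ` sphere 0 1)"
    by (intro bounded_imp_bdd_above compact_imp_bounded)
  then have "\<bar>f x\<bar> \<le> M" if "x \<in> sphere 0 1" for x
    using cSUP_upper[OF that] M unfolding lip_norm_def sup_norm_def by fastforce
  then show ?thesis
    using ext lip by (fastforce simp: lip_between_def)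
qed

section \<open>Spherical gradients of Lipschitz functions\<close>

lemma spherical_gradient_eq:
  "x \<in> sphere 0 1 \<Longrightarrow> has_spherical_gradient f v x \<Longrightarrow> spherical_gradient f x = v"
  unfolding spherical_gradient_def using has_spherical_gradient_unique by blast

lemma spherical_gradient_locally_constant:
  fixes f :: "real ^ 'n \<Rightarrow> real"
  assumes x: "x \<in> sphere 0 1" and e: "0 < e"
    and c: "\<And>y. y \<in> sphere 0 1 \<Longrightarrow> dist x y < e \<Longrightarrow> f y = f x"
  shows "spherical_gradient f x = 0"
proof (rule spherical_gradient_eq[OF x])
  have "((\<lambda>_. f x) has_derivative (\<lambda>h. 0 \<bullet> h)) (at x within sphere 0 1)"
    by simp
  then have "(f has_derivative (\<lambda>h. 0 \<bullet> h)) (at x within sphere 0 1)"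
    by (rule has_derivative_transform_within[OF _ e x]) (use c in \<open>metis dist_commute\<close>)
  then show "has_spherical_gradient f 0 x"
    by (simp add: has_spherical_gradient_def)
qed

text \<open>
  The derivative of \<open>f\<close> along the great circle that leaves \<open>x\<close> in the direction of \<open>v\<close> is \<open>norm v\<close>,
  and the great circle is parametrized by arc length, which is at least the chord length.
\<close>

lemma norm_has_spherical_gradient_le:
  fixes f :: "real ^ 'n \<Rightarrow> real"
  assumes x: "x \<in> sphere 0 1" and lip: "M-lipschitz_on (sphere 0 1) f"
    and v: "has_spherical_gradient f v x"
  shows "norm v \<le> M"
proof (cases "v = 0")
  case True
  then show ?thesis using lip by (simp add: lipschitz_on_def)
next
  case False
  define e where "e = v /\<^sub>R norm v"
  define c where "c t = cos t *\<^sub>R x + sin t *\<^sub>R e" for t :: real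
  have e: "e \<bullet> e = 1" "x \<bullet> e = 0" "x \<bullet> x = 1" "v \<bullet> e = norm v"
    using False v x by (auto simp: e_def dot_square_norm inner_commute power2_eq_square
      has_spherical_gradient_def)
  have "c t \<bullet> c t = 1" for t
    using sin_cos_squared_add2[of t] e
    by (simp add: c_def inner_add_left inner_add_right inner_commute[of e x] power2_eq_square)
  then have c: "c t \<in> sphere 0 1" for t
    by (auto simp: norm_eq_sqrt_inner)
  have c': "(c has_vector_derivative e) (at 0)"
    unfolding c_def has_vector_derivative_def by (auto intro!: derivative_eq_intros)
  have "(f has_derivative (\<lambda>h. v \<bullet> h)) (at (c 0) within range c)"
    using v c by (auto simp: has_spherical_gradient_def c_def intro: has_derivative_subset)
  from has_derivative_in_compose[OF c'[unfolded has_vector_derivative_def] this]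
  have "((\<lambda>t. f (c t)) has_real_derivative norm v) (at 0)"
    by (simp add: has_field_derivative_def e mult_commute_abs)
  then have lim_f: "(\<lambda>t. \<bar>(f (c t) - f (c 0)) / t\<bar>) \<midarrow>0\<rightarrow> \<bar>norm v\<bar>"
    by (intro tendsto_rabs) (simp add: has_field_derivative_iff)
  have "dist (c t) (c 0) \<le> \<bar>t\<bar>" for t
  proof -
    have "c t - c 0 = (cos t - 1) *\<^sub>R x + sin t *\<^sub>R e"
      by (simp add: c_def algebra_simps)
    then have "(norm (c t - c 0))\<^sup>2 = (cos t - 1)\<^sup>2 + (sin t)\<^sup>2"
      using e unfolding power2_norm_eq_inner
      by (simp add: inner_add_left inner_add_right inner_commute[of e x] power2_eq_square)
    also have "\<dots> = (2 * sin (t / 2))\<^sup>2"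
      using cos_double_sin[of "t / 2"] sin_cos_squared_add2[of t]
      by (simp add: power2_eq_square algebra_simps)
    also have "\<dots> \<le> t\<^sup>2"
      using abs_sin_x_le_abs_x[of "t / 2"]
      unfolding abs_le_square_iff[symmetric] by (simp add: abs_mult)
    finally show ?thesis
      by (simp add: dist_norm abs_le_square_iff[symmetric])
  qed
  then have "\<bar>f (c t) - f (c 0)\<bar> \<le> M * \<bar>t\<bar>" for t
    using lipschitz_onD[OF lip c c, of t 0] lipschitz_on_nonneg[OF lip]
    by (metis dist_real_def mult_left_mono order_trans)
  then have "\<bar>(f (c t) - f (c 0)) / t\<bar> \<le> M" for t
    using lipschitz_on_nonneg[OF lip] by (simp add: abs_divide divide_simps)
  then have "\<bar>norm v\<bar> \<le> M"
    by (intro tendsto_upperbound[OF lim_f]) (auto intro: always_eventually)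
  then show ?thesis by simp
qed

text \<open>
  Where \<open>f\<close> is not differentiable, its gradient is the default value of the definite description,
  which is the same vector for all functions and points. A bound that also covers this
  vector therefore holds at every point, whether or not the derivative exists there.
\<close>

lemma norm_spherical_gradient_le:
  fixes f :: "real ^ 'n \<Rightarrow> real"
  assumes x: "x \<in> sphere 0 1" and lip: "M-lipschitz_on (sphere 0 1) f"
  shows "norm (spherical_gradient f x) \<le> max M (norm (THE v :: real ^ 'n. False))"
proof (cases "\<exists>v. has_spherical_gradient f v x")
  case True
  then obtain v where "has_spherical_gradient f v x" ..
  with norm_has_spherical_gradient_le[OF x lip this] show ?thesis
    using spherical_gradient_eq[OF x] by simp
next
  case False
  then have "(\<lambda>v. has_spherical_gradient f v x) = (\<lambda>v. False)" by auto
  then show ?thesis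
    unfolding spherical_gradient_def by simp
qed

section \<open>Points are negligible\<close>

lemma space_sphere_measure: "space (sphere_measure :: (real ^ 'n) measure) = sphere 0 1"
  by (simp add: sphere_measure_def Let_def space_scale_measure)

lemma hausdorff_outer_singleton:
  assumes "0 < d"
  shows "hausdorff_outer d {p :: 'a::metric_space} = 0"
proof -
  have "hausdorff_pre d \<delta> {p} \<le> 0" if "0 < \<delta>" for \<delta>
    unfolding hausdorff_pre_def
    by (rule INF_lower2[of "\<lambda>_. {p}"]) (use that assms in \<open>auto simp: zero_power\<close>)
  then show ?thesis
    unfolding hausdorff_outer_def by (simp add: SUP_eq_iff bot_ennreal)
qed

text \<open>
  For a set \<open>A\<close> of outer measure zero, monotonicity and subadditivity are the two inequalities of
  the Caratheodory condition, which makes \<open>A\<close> measurable.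
\<close>

lemma hausdorff_outer_null_sets:
  assumes A: "A \<subseteq> X" and null: "hausdorff_outer d A = 0"
  shows "A \<in> null_sets (hausdorff_measure d X)"
proof -
  let ?O = "hausdorff_outer d"
  have "positive (Pow X) ?O" "increasing (Pow X) ?O" "countably_subadditive (Pow X) ?O"
    using outer_measure_space_hausdorff_outer[of X d] by (auto simp: outer_measure_space_def)
  then have inc: "increasing (Pow X) ?O" and sub: "subadditive (Pow X) ?O"
    using ring_of_sets.countably_subadditive_subadditive[OF ring_of_sets_Pow] by auto
  have "?O (A \<inter> B) + ?O ((X - A) \<inter> B) = ?O B" if B: "B \<subseteq> X" for B
  proof (rule antisym)
    have "?O (A \<inter> B) \<le> ?O A" "?O ((X - A) \<inter> B) \<le> ?O B"
      using A B by (auto intro!: increasingD[OF inc])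
    then show "?O (A \<inter> B) + ?O ((X - A) \<inter> B) \<le> ?O B"
      using null by simp
    have "?O ((A \<inter> B) \<union> ((X - A) \<inter> B)) \<le> ?O (A \<inter> B) + ?O ((X - A) \<inter> B)"
      using A B by (intro subadditiveD[OF sub]) auto
    moreover have "(A \<inter> B) \<union> ((X - A) \<inter> B) = B"
      using B by auto
    ultimately show "?O B \<le> ?O (A \<inter> B) + ?O ((X - A) \<inter> B)"
      by simp
  qed
  then have "A \<in> sets (hausdorff_measure d X)"
    using A by (simp add: sets_hausdorff_measure lambda_system_def)
  then show ?thesis
    using null by (simp add: null_sets_def emeasure_hausdorff_measure)
qed

lemma singleton_null_sphere_measure:
  assumes "2 \<le> CARD('n)" "p \<in> sphere (0 :: real ^ 'n) 1"
  shows "{p} \<in> null_sets (sphere_measure :: (real ^ 'n) measure)"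
proof -
  have "{p} \<in> null_sets (hausdorff_measure (CARD('n) - 1) (sphere (0 :: real ^ 'n) 1))"
    using assms by (intro hausdorff_outer_null_sets hausdorff_outer_singleton) auto
  then show ?thesis
    by (simp add: null_sets_def sphere_measure_def Let_def)
qed

text \<open>
  For \<open>CARD('n) = 1\<close> the sphere consists of two points at distance 2, which are not null sets but
  isolated. The second alternative makes the statement uniform in the dimension: at an
  isolated point every function is locally constant.
\<close>

lemma AE_sphere_measure_except_point:
  fixes p :: "real ^ 'n"
  assumes P: "\<And>x. x \<in> sphere 0 1 \<Longrightarrow> x \<noteq> p \<or> (\<forall>y \<in> sphere 0 1. dist x y < 1 \<longrightarrow> y = x) \<Longrightarrow> P x"
  shows "AE x in sphere_measure. P x"
proof (cases "2 \<le> CARD('n) \<and> p \<in> sphere 0 1")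
  case True
  then have "{p} \<in> null_sets (sphere_measure :: (real ^ 'n) measure)"
    using singleton_null_sphere_measure by blast
  then show ?thesis
    by (rule AE_I') (use P in \<open>auto simp: space_sphere_measure\<close>)
next
  case False
  have "P x" if x: "x \<in> sphere 0 1" for x
  proof (cases "x = p")
    case True
    then have "CARD('n) = 1"
      using False x by (metis One_nat_def Suc_leI less_2_cases not_le zero_less_card_finite neq0_conv)
    then obtain i :: 'n where i: "UNIV = {i}"
      by (metis card_1_singletonE)
    have nrm: "norm y = \<bar>y $ i\<bar>" for y :: "real ^ 'n"
      by (simp add: norm_vec_def i L2_set_def)
    have "y = x" if "y \<in> sphere 0 1" "dist x y < 1" for y
    proof -
      have "\<bar>y $ i\<bar> = 1" "\<bar>x $ i\<bar> = 1" "\<bar>x $ i - y $ i\<bar> < 1"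
        using that x nrm[of y] nrm[of x] nrm[of "x - y"] by (auto simp: dist_norm)
      then have "y $ i = x $ i" by linarith
      then show ?thesis
        using i by (metis UNIV_I singletonD vec_eq_iff)
    qed
    then show ?thesis using P x by blast
  qed (use P x in blast)
  then show ?thesis
    by (intro AE_I2) (simp add: space_sphere_measure)
qed

section \<open>Functions concentrated near a point\<close>

lemma tau_converges_concentrating:
  fixes G :: "nat \<Rightarrow> real ^ 'n \<Rightarrow> real"
  assumes lip: "\<And>k. M-lipschitz_on (sphere 0 1) (G k)"
    and near: "\<And>k x. x \<in> sphere 0 1 \<Longrightarrow> \<bar>G k x - c k\<bar> \<le> r k"
    and const: "\<And>k x. x \<in> sphere 0 1 \<Longrightarrow> x \<notin> cball (p k) (r k) \<Longrightarrow> G k x = c k"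
    and r: "r \<longlonglongrightarrow> 0" and p: "p \<longlonglongrightarrow> q" and c: "c \<longlonglongrightarrow> d"
  shows "tau_converges G (const_sphere d)"
  unfolding tau_converges_def
proof (intro conjI)
  have bound: "norm (sup_norm (\<lambda>x. G k x - const_sphere d x)) \<le> r k + \<bar>c k - d\<bar>" for k
  proof -
    have *: "\<bar>G k x - const_sphere d x\<bar> \<le> r k + \<bar>c k - d\<bar>" if "x \<in> sphere 0 1" for x
      using near[OF that, of k] that by (simp add: const_sphere_def)
    obtain z :: "real ^ 'n" where z: "z \<in> sphere 0 1"
      using sphere_vec_nonempty by blast
    have "0 \<le> \<bar>G k z - const_sphere d z\<bar>" by simp
    also have "\<dots> \<le> sup_norm (\<lambda>x. G k x - const_sphere d x)"
      unfolding sup_norm_def by (rule cSUP_upper[OF z], rule bdd_aboveI2, rule *)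
    finally show ?thesis
      unfolding sup_norm_def real_norm_def
      using cSUP_least[OF sphere_vec_nonempty *] by (simp del: sphere_eq_empty)
  qed
  have lim: "(\<lambda>k. r k + \<bar>c k - d\<bar>) \<longlonglongrightarrow> 0"
    using tendsto_add[OF r tendsto_rabs[OF tendsto_diff[OF c tendsto_const[of d]]]] by simp
  show "(\<lambda>k. sup_norm (\<lambda>x. G k x - const_sphere d x)) \<longlonglongrightarrow> 0"
    by (rule Lim_null_comparison[OF always_eventually[OF allI[OF bound]] lim])
  show "\<exists>C>0. AE x in sphere_measure. \<forall>k. norm (spherical_gradient (G k) x) \<le> C"
  proof (intro exI conjI)
    let ?C = "max M (norm (THE v :: real ^ 'n. False))"
    show "AE x in sphere_measure. \<forall>k. norm (spherical_gradient (G k) x) \<le> max 1 ?C"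
    proof (intro AE_I2 allI)
      fix x :: "real ^ 'n" and k
      assume "x \<in> space sphere_measure"
      then have "norm (spherical_gradient (G k) x) \<le> ?C"
        unfolding space_sphere_measure by (rule norm_spherical_gradient_le[OF _ lip])
      then show "norm (spherical_gradient (G k) x) \<le> max 1 ?C"
        by (rule max.coboundedI2)
    qed
  qed (rule less_le_trans[OF zero_less_one max.cobounded1])
  show "AE x in sphere_measure. (\<lambda>k. spherical_gradient (G k) x) \<longlonglongrightarrow>
      spherical_gradient (const_sphere d) x"
  proof (rule AE_sphere_measure_except_point[of q])
    fix x :: "real ^ 'n"
    assume x: "x \<in> sphere 0 1" and "x \<noteq> q \<or> (\<forall>y \<in> sphere 0 1. dist x y < 1 \<longrightarrow> y = x)"
    then have "\<forall>\<^sub>F k in sequentially. spherical_gradient (G k) x = 0"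
    proof (elim disjE)
      assume "x \<noteq> q"
      (* As dist x q = 3 * e, the ball of radius e about x does not meet the ball of radius r k
         about p k once p k is within e of q and r k is below e. *)
      define e where "e = dist x q / 3"
      have e: "0 < e" using \<open>x \<noteq> q\<close> by (simp add: e_def)
      have "\<forall>\<^sub>F k in sequentially. r k < e"
        using r e by (rule order_tendstoD)
      moreover have "\<forall>\<^sub>F k in sequentially. dist (p k) q < e"
        using p e by (rule tendstoD)
      ultimately show ?thesis
      proof eventually_elim
        case (elim k)
        have "G k y = c k" if "y \<in> sphere 0 1" "dist x y < e" for y
        proof (rule const[OF that(1)])
          show "y \<notin> cball (p k) (r k)"
            using elim that(2) dist_triangle[of x q y] dist_triangle[of y q "p k"]
            by (auto simp: e_def dist_commute)
        qed
        then show ?case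
          using x e by (intro spherical_gradient_locally_constant[OF x e]) auto
      qed
    qed (use x in \<open>auto intro!: always_eventually spherical_gradient_locally_constant[of x 1]\<close>)
    moreover have "spherical_gradient (const_sphere d) x = 0"
      using x by (intro spherical_gradient_locally_constant[of x 1]) (auto simp: const_sphere_def)
    ultimately show "(\<lambda>k. spherical_gradient (G k) x) \<longlonglongrightarrow> spherical_gradient (const_sphere d) x"
      by (simp add: tendsto_eventually)
  qed
qed

definition concentrated_lip :: "real \<Rightarrow> real \<Rightarrow> real \<Rightarrow> (real ^ 'n \<Rightarrow> real) set" where
  "concentrated_lip M L r =
     {g. \<exists>p \<in> sphere 0 1. \<exists>c \<in> {-L..L}. g \<in> lip_between M (c - r) (c + r) \<and>
        (\<forall>x \<in> sphere 0 1 - cball p r. g x = c)}"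

text \<open>
  The sphere and the interval \<open>{-L..L}\<close> are compact, so a sequence of counterexamples with radii
  tending to 0 has a subsequence whose centres and constants converge, and this subsequence
  is \<open>\<tau>\<close>-convergent.
\<close>

lemma bounded_on_concentrated:
  fixes V :: "(real ^ 'n \<Rightarrow> real) \<Rightarrow> real"
  assumes V: "tau_continuous V"
  shows "\<exists>r>0. \<exists>C. \<forall>g \<in> concentrated_lip M L r. \<bar>V g\<bar> \<le> C"
proof (rule ccontr)
  assume contra: "\<not> ?thesis"
  have "\<exists>g \<in> concentrated_lip M L (inverse (Suc k)). real k < \<bar>V g\<bar>" for k
  proof (rule ccontr)
    assume "\<not> ?thesis"
    then have "\<forall>g \<in> concentrated_lip M L (inverse (Suc k)). \<bar>V g\<bar> \<le> real k"
      by (simp add: not_less)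
    moreover have "0 < inverse (real (Suc k))" by simp
    ultimately show False
      using contra by blast
  qed
  then have "\<exists>g p c. p \<in> sphere 0 1 \<and> c \<in> {-L..L} \<and>
      g \<in> lip_between M (c - inverse (Suc k)) (c + inverse (Suc k)) \<and>
      (\<forall>x \<in> sphere 0 1 - cball p (inverse (Suc k)). g x = c) \<and> real k < \<bar>V g\<bar>" for k
    unfolding concentrated_lip_def by blast
  then obtain G p c where G: "\<And>k. G k \<in> lip_between M (c k - inverse (Suc k)) (c k + inverse (Suc k))"
    and p: "\<And>k. p k \<in> sphere 0 1" and c: "\<And>k. c k \<in> {-L..L}"
    and const: "\<And>k x. x \<in> sphere 0 1 - cball (p k) (inverse (Suc k)) \<Longrightarrow> G k x = c k"
    and large: "\<And>k. real k < \<bar>V (G k)\<bar>"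
    by metis
  have "compact (sphere (0 :: real ^ 'n) 1 \<times> {-L..L})"
    by (intro compact_Times) auto
  moreover have "\<forall>k. (p k, c k) \<in> sphere 0 1 \<times> {-L..L}"
    using p c by blast
  ultimately obtain z s where s: "strict_mono (s :: nat \<Rightarrow> nat)" and z: "((\<lambda>k. (p k, c k)) \<circ> s) \<longlonglongrightarrow> z"
    by (rule seq_compactE[OF compact_imp_seq_compact])
  have ps: "(\<lambda>k. p (s k)) \<longlonglongrightarrow> fst z" and cs: "(\<lambda>k. c (s k)) \<longlonglongrightarrow> snd z"
    using tendsto_fst[OF z] tendsto_snd[OF z] by (simp_all add: comp_def)
  have rs: "(\<lambda>k. inverse (real (Suc (s k)))) \<longlonglongrightarrow> 0"
    using LIMSEQ_subseq_LIMSEQ[OF LIMSEQ_inverse_real_of_nat s] by (simp add: comp_def)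
  have "tau_converges (\<lambda>k. G (s k)) (const_sphere (snd z))"
  proof (rule tau_converges_concentrating[OF _ _ _ rs ps cs])
    show "M-lipschitz_on (sphere 0 1) (G (s k))" for k
      using G by (auto simp: lip_between_def)
    show "\<bar>G (s k) x - c (s k)\<bar> \<le> inverse (real (Suc (s k)))" if "x \<in> sphere 0 1" for k x
      using G[of "s k"] that by (force simp: lip_between_def abs_le_iff)
  qed (use const in auto)
  moreover have "G (s k) \<in> Lip_sphere" for k
    using G by (rule lip_between_Lip_sphere)
  moreover have "(const_sphere (snd z) :: real ^ 'n \<Rightarrow> real) \<in> Lip_sphere"
    using const_sphere_lip_between[of 0 "snd z"] lip_between_Lip_sphere by blast
  ultimately have "(\<lambda>k. V (G (s k))) \<longlonglongrightarrow> V (const_sphere (snd z))"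
    using V[unfolded tau_continuous_def, rule_format, of "\<lambda>k. G (s k)" "const_sphere (snd z)"]
    by simp
  then have "Bseq (\<lambda>k. V (G (s k)))"
    by (intro convergent_imp_Bseq convergentI)
  then obtain B where B: "\<And>k. \<bar>V (G (s k))\<bar> \<le> B"
    by (auto simp: Bseq_def)
  obtain k where "B < real k"
    using reals_Archimedean2 by blast
  also have "real k \<le> real (s k)"
    using seq_suble[OF s] by simp
  also have "\<dots> < \<bar>V (G (s k))\<bar>" by (rule large)
  finally show False using B[of k] by simp
qed

section \<open>Cutting with cones and constants\<close>

lemma valuation_cut:
  assumes "valuation V" "f \<in> Lip_sphere" "\<phi> \<in> Lip_sphere"
    and "\<bar>V (\<lambda>x. max (f x) (\<phi> x))\<bar> \<le> A" "\<bar>V (\<lambda>x. min (f x) (\<phi> x))\<bar> \<le> B"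
  shows "\<bar>V f\<bar> \<le> A + B + \<bar>V \<phi>\<bar>"
proof -
  have "V (\<lambda>x. max (f x) (\<phi> x)) + V (\<lambda>x. min (f x) (\<phi> x)) = V f + V \<phi>"
    using assms unfolding valuation_def by blast
  then show ?thesis using assms by linarith
qed

text \<open>
  The cone \<open>M * dist p x - s\<close> is clamped to \<open>[0, s]\<close>: the value is \<open>a\<close> within distance
  \<open>s / M\<close> of \<open>p\<close>, and \<open>a + s\<close> beyond distance \<open>2 * s / M\<close>. The plateau around \<open>p\<close> is what lets
  finitely many cones flatten a function completely.
\<close>

definition truncated_cone :: "real \<Rightarrow> real \<Rightarrow> real \<Rightarrow> real ^ 'n \<Rightarrow> real ^ 'n \<Rightarrow> real" where
  "truncated_cone M a s p = restrict (\<lambda>x. a + min s (max 0 (M * dist p x - s))) (sphere 0 1)"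

lemma truncated_cone_lip_between:
  assumes "0 \<le> M" "0 \<le> s"
  shows "truncated_cone M a s p \<in> lip_between M a (a + s)"
proof -
  have "dist (truncated_cone M a s p x) (truncated_cone M a s p y) \<le> M * dist x y"
    if "x \<in> sphere 0 1" "y \<in> sphere 0 1" for x y
  proof -
    have "\<bar>M * dist p x - M * dist p y\<bar> = M * \<bar>dist p x - dist p y\<bar>"
      using assms by (simp add: abs_mult flip: right_diff_distrib)
    also have "\<dots> \<le> M * dist x y"
      using assms abs_dist_diff_le[of x p y] by (intro mult_left_mono) (auto simp: dist_commute)
    finally show ?thesis
      using that by (simp add: truncated_cone_def dist_real_def)
  qed
  then show ?thesis
    using assms by (auto simp: lip_between_def lipschitz_on_def) (auto simp: truncated_cone_def)
qed

text \<open>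
  Induction on the finite set \<open>P\<close> of centres, over functions equal to \<open>a\<close> outside the balls
  about \<open>P\<close>. Cutting with the cone over a new centre \<open>p\<close> leaves, from below, a function that equals
  \<open>a\<close> also on the ball about \<open>p\<close>, to which the induction hypothesis applies. The assumption
  \<open>2 * s \<le> M * r\<close> makes the cone reach its maximum within distance \<open>r\<close> of \<open>p\<close>.
\<close>

lemma bounded_on_thin:
  fixes V :: "(real ^ 'n \<Rightarrow> real) \<Rightarrow> real"
  assumes V: "valuation V" and M: "0 < M" and s: "0 < s" "s \<le> r" "2 * s \<le> M * r" and a: "\<bar>a + s\<bar> \<le> L"
    and conc: "\<And>g. g \<in> concentrated_lip M L r \<Longrightarrow> \<bar>V g\<bar> \<le> C"
  shows "\<exists>B. \<forall>f \<in> lip_between M a (a + s). \<bar>V f\<bar> \<le> B"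
proof -
  have "0 < s / M" using M s by simp
  then have "sphere (0 :: real ^ 'n) 1 \<subseteq> (\<Union>p \<in> sphere 0 1. ball p (s / M))"
    by auto
  then obtain P where P: "finite P" "P \<subseteq> sphere (0 :: real ^ 'n) 1"
    and cover: "sphere 0 1 \<subseteq> (\<Union>p \<in> P. ball p (s / M))"
    by (rule compactE_image[OF compact_sphere open_ball])
  have "\<exists>B. \<forall>f \<in> lip_between M a (a + s).
      (\<forall>x \<in> sphere 0 1 - (\<Union>p \<in> P. ball p (s / M)). f x = a) \<longrightarrow> \<bar>V f\<bar> \<le> B"
    using P
  proof (induction P rule: finite_induct)
    case empty
    have "f = const_sphere a" if "f \<in> lip_between M a (a + s)" "\<forall>x \<in> sphere 0 1. f x = a" for f
      using that by (intro extensionalityI[of f "sphere 0 1"]) (auto simp: lip_between_def const_sphere_def)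
    then show ?case
      by (intro exI[of _ "\<bar>V (const_sphere a)\<bar>"]) fastforce
  next
    case (insert p P)
    then obtain B where B: "\<forall>f \<in> lip_between M a (a + s).
        (\<forall>x \<in> sphere 0 1 - (\<Union>p \<in> P. ball p (s / M)). f x = a) \<longrightarrow> \<bar>V f\<bar> \<le> B"
      by auto
    let ?\<phi> = "truncated_cone M a s p"
    have \<phi>: "?\<phi> \<in> lip_between M a (a + s)"
      using M s by (intro truncated_cone_lip_between) auto
    have "\<bar>V f\<bar> \<le> C + B + \<bar>V ?\<phi>\<bar>" if f: "f \<in> lip_between M a (a + s)"
      and fa: "\<And>x. x \<in> sphere 0 1 - (\<Union>p \<in> insert p P. ball p (s / M)) \<Longrightarrow> f x = a" for f
    proof (rule valuation_cut[OF V lip_between_Lip_sphere[OF f] lip_between_Lip_sphere[OF \<phi>]])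
      have fb: "a \<le> f x" "f x \<le> a + s" if "x \<in> sphere 0 1" for x
        using f that by (auto simp: lip_between_def)
      show "\<bar>V (\<lambda>x. max (f x) (?\<phi> x))\<bar> \<le> C"
      proof (rule conc, unfold concentrated_lip_def, intro CollectI bexI[of _ p] bexI[of _ "a + s"] conjI ballI)
        show "(\<lambda>x. max (f x) (?\<phi> x)) \<in> lip_between M (a + s - r) (a + s + r)"
          using lip_between_max[OF f \<phi>] s by (force simp: lip_between_def)
        show "max (f x) (?\<phi> x) = a + s" if x: "x \<in> sphere 0 1 - cball p r" for x
        proof -
          have "M * r \<le> M * dist p x"
            using x M by (intro mult_left_mono) auto
          then have "?\<phi> x = a + s"
            using x s by (simp add: truncated_cone_def)
          then show ?thesis using fb x by simp
        qed
      qed (use insert.prems a in \<open>auto simp: abs_le_iff\<close>)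
      show "\<bar>V (\<lambda>x. min (f x) (?\<phi> x))\<bar> \<le> B"
      proof (rule B[rule_format])
        show "(\<lambda>x. min (f x) (?\<phi> x)) \<in> lip_between M a (a + s)"
          using lip_between_min[OF f \<phi>] by simp
        fix x assume x: "x \<in> sphere 0 1 - (\<Union>p \<in> P. ball p (s / M))"
        show "min (f x) (?\<phi> x) = a"
        proof (cases "x \<in> ball p (s / M)")
          case True
          then have "M * dist p x < s"
            using M by (simp add: pos_less_divide_eq mult.commute)
          then have "?\<phi> x = a"
            using x s by (simp add: truncated_cone_def)
          then show ?thesis using x fb by simp
        next
          case False
          then have "f x = a" using fa x by auto
          moreover have "a \<le> ?\<phi> x" using \<phi> x by (auto simp: lip_between_def)
          ultimately show ?thesis by simp
        qed
      qed
    qed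
    then show ?case by blast
  qed
  then show ?thesis using cover by blast
qed

theorem lemma3p2:
  fixes V :: "(real ^ 'n \<Rightarrow> real) \<Rightarrow> real"
  assumes "valuation V" and "tau_continuous V"
  shows "\<forall>M>0. bdd_above {\<bar>V f\<bar> | f. f \<in> Lip_sphere \<and> lip_norm f \<le> M}"
proof (intro allI impI)
  fix M :: real assume M: "0 < M"
  obtain r C where r: "0 < r" and conc:
    "\<And>g. g \<in> concentrated_lip M M r \<Longrightarrow> \<bar>V g\<bar> \<le> C"
    using bounded_on_concentrated[OF assms(2)] by metis
  (* Slabs of thickness at most r stay within r of a constant, and those of thickness at most
     M * r / 2 leave room for a cone of slope M inside a ball of radius r. *)
  define m where "m = min r (M * r / 2)"
  have m: "0 < m" using r M by (simp add: m_def)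
  obtain N where N: "2 * M / m < real N"
    using reals_Archimedean2 by blast
  then have "0 < N"
    using m M by (metis divide_nonneg_pos less_eq_real_def linorder_not_less mult_nonneg_nonneg of_nat_0 zero_le_numeral neq0_conv)
  define s where "s = 2 * M / N"
  have s: "0 < s" "s \<le> r" "2 * s \<le> M * r" and Ns: "N * s = 2 * M"
  proof -
    have "s \<le> m"
      using N m \<open>0 < N\<close> by (simp add: s_def field_simps)
    then show "s \<le> r" "2 * s \<le> M * r" by (auto simp: m_def)
  qed (use M \<open>0 < N\<close> in \<open>auto simp: s_def\<close>)
  (* Each induction step cuts off the top slab, of thickness s. *)
  have "\<exists>B. \<forall>f \<in> lip_between M (- M) (- M + real k * s). \<bar>V f\<bar> \<le> B" if "k \<le> N" for k
    using that
  proof (induction k)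
    case 0
    have "f = const_sphere (- M)" if "f \<in> lip_between M (- M) (- M)" for f
      using that by (intro extensionalityI[of f "sphere 0 1"]) (force simp: lip_between_def const_sphere_def)+
    then show ?case
      by (intro exI[of _ "\<bar>V (const_sphere (- M))\<bar>"]) fastforce
  next
    case (Suc k)
    define a where "a = - M + real k * s"
    have a': "- M + real (Suc k) * s = a + s"
      by (simp add: a_def algebra_simps)
    have "real (Suc k) * s \<le> N * s"
      using Suc.prems s by (intro mult_right_mono) auto
    then have "\<bar>a + s\<bar> \<le> M"
      unfolding a'[symmetric] using Ns s by (simp add: abs_le_iff)
    from bounded_on_thin[OF assms(1) M s this conc]
    obtain B1 where B1: "\<And>f. f \<in> lip_between M a (a + s) \<Longrightarrow> \<bar>V f\<bar> \<le> B1"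
      by blast
    obtain B2 where B2: "\<And>f. f \<in> lip_between M (- M) a \<Longrightarrow> \<bar>V f\<bar> \<le> B2"
      using Suc unfolding a_def by auto
    have Ma: "- M \<le> a" using s by (simp add: a_def)
    have cst: "const_sphere a \<in> lip_between M a a"
      using M by (intro const_sphere_lip_between) auto
    have "\<bar>V f\<bar> \<le> B1 + B2 + \<bar>V (const_sphere a)\<bar>" if f: "f \<in> lip_between M (- M) (a + s)" for f
    proof (rule valuation_cut[OF assms(1) lip_between_Lip_sphere[OF f] lip_between_Lip_sphere[OF cst]])
      show "\<bar>V (\<lambda>x. max (f x) (const_sphere a x))\<bar> \<le> B1"
        using lip_between_max[OF f cst] Ma s by (intro B1) (simp add: max_absorb1 max_absorb2)
      show "\<bar>V (\<lambda>x. min (f x) (const_sphere a x))\<bar> \<le> B2"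
        using lip_between_min[OF f cst] Ma s by (intro B2) (simp add: min_absorb1 min_absorb2)
    qed
    then show ?case unfolding a' by blast
  qed
  from this[of N] obtain B where B: "\<And>f. f \<in> lip_between M (- M) M \<Longrightarrow> \<bar>V f\<bar> \<le> B"
    using Ns by auto
  show "bdd_above {\<bar>V f\<bar> | f. f \<in> Lip_sphere \<and> lip_norm f \<le> M}"
    using lip_norm_le_lip_between[of _ M] M B by (auto simp: bdd_above_def intro!: exI[of _ B])
qed

end
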